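(* Let $r\in\{1,2\}$, $p,q>0$, let $F_{\gamma_d}$ be the cumulative distribution function of the instantaneous SNR $\gamma_d$ of the destination link defined in the context, and let $$\mathrm{ABER}=\frac{q^{p}}{2\Gamma(p)}\int_0^\infty e^{-q\gamma}\gamma^{p-1}F_{\gamma_d}(\gamma)\,d\gamma$$ be the average bit error rate. At high SNR, i.e. as $\mu_{r,d}\to\infty$ with $r,p,q,l_d,\Lambda_{3,d},\Lambda_{4,d}$ fixed, $\mathrm{ABER}\approx\mathrm{ABER}^\infty$ in the sense that $\mathrm{ABER}/\mathrm{ABER}^{\infty}\to1$, where $$\mathrm{ABER}^{\infty}=\sum_{h=1}^{r}\frac{\Lambda_{3,d}\,(q\mu_{r,d})^{t_{1,h}-\frac{l_d}{r}-1}}{2\sqrt r\,\Gamma(p)\,\Lambda_{4,d}^{t_{1,h}-1}}\cdot\frac{\prod_{g=1,\,g\ne h}^{r}\Gamma(t_{1,h}-t_{1,g})\;\prod_{g=1}^{2}\Gamma(1+t_{2,g}-t_{1,h})}{\Gamma(1+t_{1,r+1}-t_{1,h})},$$ with $t_1=(t_{1,1},\dots,t_{1,r+1})$ equal to $(1,1+l_d)$ if $r=1$ and $(1,\tfrac12,1+\tfrac{l_d}{2})$ if $r=2$, and $t_2=(t_{2,1},t_{2,2})=\left(p+\frac{l_d}{r},\frac{l_d}{r}\right)$.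
   Context: Model. $M$ is a positive random variable (the two-hop channel gain through one reflecting element of the reconfigurable intelligent surface: a product of two independent inverted Gamma-Gamma turbulence variables with pointing errors) with mean $E=\mathbb{E}(M)>0$ and variance $0<\mathrm{Var}(M)<\infty$; only $E$ and $\mathrm{Var}(M)$ enter. $N_d\ge1$ is the number of reflecting elements, $l_d=N_dE^2/\mathrm{Var}(M)$, $k_d=\mathrm{Var}(M)/E$. The sum of the $N_d$ gains is modelled by $\bar M_d$ with density $\frac{y^{l_d-1}}{\Gamma(l_d)k_d^{l_d}}e^{-y/k_d}$, $y>0$. The instantaneous SNR is $\gamma_d=\mu_{r,d}(\bar M_d/E)^r$, where $\mu_{r,d}>0$ is the electrical SNR and $r$ is the detection type ($r=1$ heterodyne, $r=2$ intensity modulation/direct detection). The pair $(p,q)$ encodes the modulation scheme. Constants: $\Lambda_{3,d}=\frac{E^{l_d}}{\Gamma(l_d)k_d^{l_d}(2\pi)^{(r-1)/2}}$, $\Lambda_{4,d}=\left[\frac{E}{k_dr}\right]^r$. *)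

theory Defs
  imports "HOL-Probability.Probability"
begin

text \<open>Channel parameters, as functions of the number n of reflecting elements and of the mean E
  and variance V of the gain of a single element.\<close>

definition l_d :: "nat \<Rightarrow> real \<Rightarrow> real \<Rightarrow> real" where
  "l_d n E V = real n * E\<^sup>2 / V"

definition k_d :: "real \<Rightarrow> real \<Rightarrow> real" where
  "k_d E V = V / E"

definition gamma_density :: "real \<Rightarrow> real \<Rightarrow> real \<Rightarrow> real" where
  "gamma_density l k y =
     (if y > 0 then y powr (l - 1) / (Gamma l * k powr l) * exp (- y / k) else 0)"

definition snr :: "nat \<Rightarrow> real \<Rightarrow> real \<Rightarrow> ('a \<Rightarrow> real) \<Rightarrow> 'a \<Rightarrow> real" where
  "snr r E \<mu> Mbar = (\<lambda>\<omega>. \<mu> * (Mbar \<omega> / E) ^ r)"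

definition snr_cdf :: "'a measure \<Rightarrow> nat \<Rightarrow> real \<Rightarrow> ('a \<Rightarrow> real) \<Rightarrow> real \<Rightarrow> real \<Rightarrow> real" where
  "snr_cdf Q r E Mbar \<mu> = cdf (distr Q borel (snr r E \<mu> Mbar))"

definition aber :: "real \<Rightarrow> real \<Rightarrow> (real \<Rightarrow> real) \<Rightarrow> real" where
  "aber p q F = q powr p / (2 * Gamma p) *
     (LINT x:{0<..}|lborel. exp (- q * x) * x powr (p - 1) * F x)"

definition Lambda3 :: "nat \<Rightarrow> real \<Rightarrow> real \<Rightarrow> real \<Rightarrow> real" where
  "Lambda3 r E l k = E powr l / (Gamma l * k powr l * (2 * pi) powr ((real r - 1) / 2))"

definition Lambda4 :: "nat \<Rightarrow> real \<Rightarrow> real \<Rightarrow> real" where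
  "Lambda4 r E k = (E / (k * real r)) ^ r"

text \<open>The parameter tuples are indexed from 1, and only r = 1 and r = 2 are meaningful.\<close>

definition t1 :: "nat \<Rightarrow> real \<Rightarrow> nat \<Rightarrow> real" where
  "t1 r l h = (if r = 1 then [1, 1 + l] else [1, 1 / 2, 1 + l / 2]) ! (h - 1)"

definition t2 :: "nat \<Rightarrow> real \<Rightarrow> real \<Rightarrow> nat \<Rightarrow> real" where
  "t2 r p l g = [p + l / real r, l / real r] ! (g - 1)"

definition aber_inf ::
  "nat \<Rightarrow> real \<Rightarrow> real \<Rightarrow> real \<Rightarrow> real \<Rightarrow> real \<Rightarrow> real \<Rightarrow> real" where
  "aber_inf r p q l L3 L4 \<mu> =
     (\<Sum>h = 1..r.
        L3 * (q * \<mu>) powr (t1 r l h - l / real r - 1)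
          / (2 * sqrt (real r) * Gamma p * L4 powr (t1 r l h - 1))
        * ((\<Prod>g\<in>{1..r} - {h}. Gamma (t1 r l h - t1 r l g))
            * (\<Prod>g = 1..2. Gamma (1 + t2 r p l g - t1 r l h))
           / Gamma (1 + t1 r l (r + 1) - t1 r l h)))"

end

(* Since the signal is a gamma variable with shape l, its distribution function satisfies
   C z^l exp (-z/k) <= F(z) <= C z^l with C = 1 / (l Gamma(l) k^l). Substituting
   z = E (x/mu)^(1/r), the rescaled cdf mu^(l/r) F_gamma(x) is dominated by a multiple of
   x^(l/r) and converges to it, so dominated convergence turns the bit error rate into a
   Gamma integral. On the other side, only the summand h = 1 of the asymptotic expression has
   order mu^(-l/r); for r = 2 the other one is smaller by a factor mu^(-1/2). *)

theory Submission
  imports Defs "HOL-Real_Asymp.Real_Asymp"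
begin

text \<open>Euler's integral for \<open>Gamma s\<close> after the substitution t = q x. The closed
  and the open half-line give the same integrand at every point, since
  \<open>0 powr (s - 1) = 0\<close>.\<close>

lemma has_bochner_integral_Gamma_scaled:
  fixes s q :: real
  assumes "s > 0" "q > 0"
  shows "has_bochner_integral lborel
           (\<lambda>x. indicator {0<..} x * (exp (- q * x) * x powr (s - 1))) (Gamma s / q powr s)"
proof -
  let ?f = "\<lambda>t::real. indicator {0..} t * t powr (s - 1) / exp t"
  have "has_bochner_integral lborel ?f (Gamma s)"
  proof (rule has_bochner_integral_nn_integral)
    show "(\<integral>\<^sup>+ t. ennreal (?f t) \<partial>lborel) = ennreal (Gamma s)"
      using Gamma_conv_nn_integral_real[OF assms(1)] by simp
  qed (use assms in \<open>auto simp: Gamma_real_nonneg\<close>)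
  hence "has_bochner_integral lborel (\<lambda>x. ?f (0 + q * x)) (Gamma s /\<^sub>R \<bar>q\<bar>)"
    using assms by (subst (asm) lborel_has_bochner_integral_real_affine_iff[where c = q and t = 0]) auto
  \<comment> \<open>The power \<open>(q * x) powr (s - 1)\<close> leaves behind a factor
    \<open>q powr (s - 1)\<close>, which is compensated here.\<close>
  hence "has_bochner_integral lborel (\<lambda>x. q powr (1 - s) * ?f (0 + q * x))
           (q powr (1 - s) * (Gamma s /\<^sub>R \<bar>q\<bar>))"
    by (rule has_bochner_integral_mult_right)
  moreover have "q powr (1 - s) * (Gamma s /\<^sub>R \<bar>q\<bar>) = Gamma s / q powr s"
    using assms by (simp add: powr_diff field_simps)
  moreover have "(\<lambda>x. q powr (1 - s) * ?f (0 + q * x)) =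
      (\<lambda>x. indicator {0<..} x * (exp (- q * x) * x powr (s - 1)))"
  proof
    fix x :: real
    show "q powr (1 - s) * ?f (0 + q * x) =
      indicator {0<..} x * (exp (- q * x) * x powr (s - 1))"
      using assms
      by (cases "x > 0")
        (auto simp: indicator_def powr_mult powr_diff exp_minus field_simps zero_le_mult_iff)
  qed
  ultimately show ?thesis by simp
qed

text \<open>Dominated convergence for a family F scaled by \<mu>^a. The bound and the pointwise
  limit share the constant c, so the single function \<open>w\<close> is both the integrable
  majorant and the limit of the integrands; its integral is a Gamma integral with parameter p +
  a.\<close>

lemma aber_scaled_tendsto:
  fixes F :: "real \<Rightarrow> real \<Rightarrow> real"
  assumes "p > 0" "q > 0" "a \<ge> 0"
    and meas: "\<And>\<mu>. F \<mu> \<in> borel_measurable borel"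
    and nonneg: "\<And>\<mu> x. \<mu> > 0 \<Longrightarrow> x > 0 \<Longrightarrow> 0 \<le> F \<mu> x"
    and bound: "\<And>\<mu> x. \<mu> > 0 \<Longrightarrow> x > 0 \<Longrightarrow> \<mu> powr a * F \<mu> x \<le> c * x powr a"
    and lim: "\<And>x. x > 0 \<Longrightarrow> ((\<lambda>\<mu>. \<mu> powr a * F \<mu> x) \<longlongrightarrow> c * x powr a) at_top"
  shows "((\<lambda>\<mu>. \<mu> powr a * aber p q (F \<mu>)) \<longlongrightarrow> c * Gamma (p + a) / (2 * Gamma p * q powr a)) at_top"
proof -
  define s where "s = (\<lambda>\<mu> x. indicator {0<..} x * (exp (- q * x) * x powr (p - 1) * (\<mu> powr a * F \<mu> x)))"
  define w where "w = (\<lambda>x::real. c * (indicator {0<..} x * (exp (- q * x) * x powr (p + a - 1))))"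
  have w: "has_bochner_integral lborel w (c * (Gamma (p + a) / q powr (p + a)))"
    unfolding w_def using assms(1-3)
    by (intro has_bochner_integral_mult_right has_bochner_integral_Gamma_scaled) auto
  \<comment> \<open>Splitting x^(p+a-1) into x^(p-1) and x^a gives \<open>w\<close> the shape of
    \<open>s\<close>, so that \<open>bound\<close> and \<open>lim\<close> apply to the last factor
    alone.\<close>
  have w_alt: "w x = indicator {0<..} x * (exp (- q * x) * x powr (p - 1) * (c * x powr a))" for x
    by (cases "x > 0") (auto simp: w_def powr_add[symmetric] algebra_simps)
  have "((\<lambda>\<mu>. integral\<^sup>L lborel (s \<mu>)) \<longlongrightarrow> integral\<^sup>L lborel w) at_top"
  proof (rule integral_dominated_convergence_at_top)
    show "w \<in> borel_measurable lborel" "integrable lborel w"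
      using w by (auto simp: has_bochner_integral_iff)
    show "s \<mu> \<in> borel_measurable lborel" for \<mu>
      unfolding s_def using meas[of \<mu>] by measurable
    show "\<forall>\<^sub>F \<mu> in at_top. AE x in lborel. norm (s \<mu> x) \<le> w x"
      using eventually_gt_at_top[of 0]
    proof eventually_elim
      case (elim \<mu>)
      have "norm (s \<mu> x) \<le> w x" for x
        using nonneg[OF elim, of x] bound[OF elim, of x]
        by (cases "x > 0") (auto simp: s_def w_alt abs_mult intro!: mult_left_mono)
      thus ?case by simp
    qed
    have "((\<lambda>\<mu>. s \<mu> x) \<longlongrightarrow> w x) at_top" for x
    proof (cases "x > 0")
      case True
      show ?thesis unfolding s_def w_alt by (intro tendsto_intros lim True)
    qed (simp add: s_def w_def)
    thus "AE x in lborel. ((\<lambda>\<mu>. s \<mu> x) \<longlongrightarrow> w x) at_top" by simp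
  qed
  hence "((\<lambda>\<mu>. q powr p / (2 * Gamma p) * integral\<^sup>L lborel (s \<mu>)) \<longlongrightarrow>
      q powr p / (2 * Gamma p) * (c * (Gamma (p + a) / q powr (p + a)))) at_top"
    using w by (intro tendsto_mult_left) (simp add: has_bochner_integral_iff)
  moreover have "q powr p / (2 * Gamma p) * integral\<^sup>L lborel (s \<mu>) = \<mu> powr a * aber p q (F \<mu>)" for \<mu>
  proof -
    have "integral\<^sup>L lborel (s \<mu>) =
        (LINT x|lborel. \<mu> powr a * (indicator {0<..} x *\<^sub>R (exp (- q * x) * x powr (p - 1) * F \<mu> x)))"
      by (intro Bochner_Integration.integral_cong) (auto simp: s_def)
    thus ?thesis by (simp add: aber_def set_lebesgue_integral_def)
  qed
  moreover have "q powr p / (2 * Gamma p) * (c * (Gamma (p + a) / q powr (p + a))) =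
      c * Gamma (p + a) / (2 * Gamma p * q powr a)"
    using assms by (simp add: powr_add)
  ultimately show ?thesis by simp
qed

text \<open>For 0 < y \<le> z the factor exp (-y/k) of the density lies between exp (-z/k) and 1.
  What remains is a power of y, and integrating it over [0, z] produces z^l / l.\<close>

lemma gamma_distributed_measure_le:
  assumes "prob_space Q"
    and X: "distributed Q lborel X (\<lambda>y. ennreal (gamma_density l k y))"
    and "l > 0" "k > 0" "z \<ge> 0"
  defines "C \<equiv> 1 / (l * Gamma l * k powr l)"
  shows "measure Q (X -` {..z} \<inter> space Q) \<le> C * z powr l"
    and "C * z powr l * exp (- z / k) \<le> measure Q (X -` {..z} \<inter> space Q)"
proof -
  interpret prob_space Q by fact
  let ?D = "1 / (Gamma l * k powr l)"
  have G: "Gamma l > 0" using assms by (auto intro: Gamma_real_pos)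
  \<comment> \<open>The constant b stays free because both bounds use this integral: the upper one
    with \<open>?D\<close>, the lower one with \<open>?D * exp (- z / k)\<close>.\<close>
  have I: "(\<integral>\<^sup>+ y. ennreal (b * y powr (l - 1)) * indicator {0..z} y \<partial>lborel) = ennreal (b * (z powr l / l))"
    if "b \<ge> 0" for b
    using nn_integral_has_integral_lebesgue'[OF _ has_integral_mult_right[OF
      has_integral_powr_from_0[of "l - 1" z]], of b] that assms by simp
  have eq: "ennreal (measure Q (X -` {..z} \<inter> space Q)) =
      (\<integral>\<^sup>+ y. ennreal (gamma_density l k y) * indicator {..z} y \<partial>lborel)"
    using distributed_emeasure[OF X, of "{..z}"] by (simp add: emeasure_eq_measure)
  also have "\<dots> \<le> (\<integral>\<^sup>+ y. ennreal (?D * y powr (l - 1)) * indicator {0..z} y \<partial>lborel)"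
    using G \<open>k > 0\<close>
    by (intro nn_integral_mono)
      (auto simp: gamma_density_def indicator_def intro!: ennreal_leI mult_left_le divide_right_mono)
  also have "\<dots> = ennreal (C * z powr l)"
    using G by (subst I) (auto simp: C_def field_simps)
  finally show "measure Q (X -` {..z} \<inter> space Q) \<le> C * z powr l"
    using assms G by (simp add: C_def)
  have "ennreal (C * z powr l * exp (- z / k)) = ennreal (?D * exp (- z / k) * (z powr l / l))"
    by (simp add: C_def field_simps)
  also have "\<dots> = (\<integral>\<^sup>+ y. ennreal (?D * exp (- z / k) * y powr (l - 1)) * indicator {0..z} y \<partial>lborel)"
    using G by (subst I) auto
  also have "\<dots> \<le> (\<integral>\<^sup>+ y. ennreal (gamma_density l k y) * indicator {..z} y \<partial>lborel)"
  proof (intro nn_integral_mono)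
    fix y :: real
    show "ennreal (?D * exp (- z / k) * y powr (l - 1)) * indicator {0..z} y
        \<le> ennreal (gamma_density l k y) * indicator {..z} y"
    proof (cases "0 < y \<and> y \<le> z")
      case True
      have "exp (- z / k) * y powr (l - 1) \<le> exp (- y / k) * y powr (l - 1)"
        using True \<open>k > 0\<close> by (intro mult_right_mono) (auto simp: field_simps)
      hence "?D * (exp (- z / k) * y powr (l - 1)) \<le> ?D * (exp (- y / k) * y powr (l - 1))"
        using G by (intro mult_left_mono) auto
      thus ?thesis using True by (auto simp: gamma_density_def mult_ac intro!: ennreal_leI)
    next
      \<comment> \<open>At y = 0 the left side vanishes because \<open>0 powr (l - 1) = 0\<close>;
        at every other point outside (0, z] its indicator is 0.\<close>
      case False
      thus ?thesis by (cases "y = 0") (auto simp: indicator_def)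
    qed
  qed
  also note eq[symmetric]
  finally show "C * z powr l * exp (- z / k) \<le> measure Q (X -` {..z} \<inter> space Q)"
    by (simp add: ennreal_le_iff)
qed

text \<open>The map y \<mapsto> \<mu> (y/E)^r is increasing on the positive half-line only, since
  for even r it is not monotone on the whole line. The density makes X positive almost surely, so
  inverting the map there changes the event by a null set at most.\<close>

lemma snr_cdf_eq:
  assumes X: "distributed Q lborel X (\<lambda>y. ennreal (gamma_density l k y))"
    and "E > 0" "\<mu> > 0" "x > 0" "r > 0"
  shows "snr_cdf Q r E X \<mu> x = measure Q (X -` {..E * (x / \<mu>) powr (1 / real r)} \<inter> space Q)"
proof -
  have [measurable]: "X \<in> borel_measurable Q"
    using distributed_measurable[OF X] by simp
  have "AE y in distr Q lborel X. y > 0"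
    unfolding distributed_distr_eq_density[OF X]
    using distributed_borel_measurable[OF X]
    by (subst AE_density) (auto simp: gamma_density_def)
  hence "AE \<omega> in Q. X \<omega> > 0"
    by (rule AE_distrD[rotated]) simp
  moreover have "\<mu> * (y / E) ^ r \<le> x \<longleftrightarrow> y \<le> E * (x / \<mu>) powr (1 / real r)" if "y > 0" for y
  proof -
    have "\<mu> * (y / E) ^ r \<le> x \<longleftrightarrow> (y / E) ^ r \<le> ((x / \<mu>) powr (1 / real r)) ^ r"
      using assms by (simp add: powr_realpow[symmetric] powr_powr field_simps del: powr_realpow)
    also have "\<dots> \<longleftrightarrow> y / E \<le> (x / \<mu>) powr (1 / real r)"
      using assms that by (intro power_mono_iff) auto
    also have "\<dots> \<longleftrightarrow> y \<le> E * (x / \<mu>) powr (1 / real r)"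
      using assms by (simp add: field_simps)
    finally show ?thesis .
  qed
  ultimately have "measure Q (snr r E \<mu> X -` {..x} \<inter> space Q) =
      measure Q (X -` {..E * (x / \<mu>) powr (1 / real r)} \<inter> space Q)"
    by (intro measure_eq_AE) (auto simp: snr_def)
  thus ?thesis
    by (simp add: snr_cdf_def cdf_def measure_distr snr_def)
qed

text \<open>The general limit is applied with a = l/r. The upper bound on the distribution function
  provides the majorant; the lower bound differs from it by an exponential factor that tends to
  1.\<close>

lemma aber_snr_scaled_tendsto:
  assumes Q: "prob_space Q"
    and X: "distributed Q lborel X (\<lambda>y. ennreal (gamma_density l k y))"
    and "l > 0" "k > 0" "E > 0" "r > 0" "p > 0" "q > 0"
  shows "((\<lambda>\<mu>. \<mu> powr (l / real r) * aber p q (snr_cdf Q r E X \<mu>)) \<longlongrightarrow>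
      (E / k) powr l * Gamma (p + l / real r) /
        (l * Gamma l * (2 * Gamma p) * q powr (l / real r))) at_top"
proof -
  interpret prob_space Q by fact
  have [measurable]: "X \<in> borel_measurable Q"
    using distributed_measurable[OF X] by simp
  have G: "Gamma l > 0" using assms by (auto intro: Gamma_real_pos)
  let ?a = "l / real r"
  define c where "c = (E / k) powr l / (l * Gamma l)"
  define e where "e = (\<lambda>\<mu> x. exp (- (E * (x / \<mu>) powr (1 / real r)) / k))"
  \<comment> \<open>With z = E (x/\<mu>)^(1/r), the power z^l equals E^l (x/\<mu>)^(l/r), so \<mu>
    cancels exactly and only the factor \<open>e\<close> still depends on it.\<close>
  have scale: "\<mu> powr ?a * (1 / (l * Gamma l * k powr l) * (E * (x / \<mu>) powr (1 / real r)) powr l)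
      = c * x powr ?a" if "\<mu> > 0" "x > 0" for \<mu> x
    using that assms G by (simp add: c_def powr_mult powr_divide powr_powr field_simps)
  have *: "\<mu> powr ?a * snr_cdf Q r E X \<mu> x \<le> c * x powr ?a"
      "c * x powr ?a * e \<mu> x \<le> \<mu> powr ?a * snr_cdf Q r E X \<mu> x" if "\<mu> > 0" "x > 0" for \<mu> x
  proof -
    let ?z = "E * (x / \<mu>) powr (1 / real r)"
    have z: "?z \<ge> 0" using assms by simp
    note b = gamma_distributed_measure_le[OF Q X \<open>l > 0\<close> \<open>k > 0\<close> z]
    note F = snr_cdf_eq[OF X \<open>E > 0\<close> that \<open>r > 0\<close>]
    show "\<mu> powr ?a * snr_cdf Q r E X \<mu> x \<le> c * x powr ?a"
      unfolding scale[OF that, symmetric] F by (intro mult_left_mono b) auto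
    have "\<mu> powr ?a * (1 / (l * Gamma l * k powr l) * ?z powr l * exp (- ?z / k))
        \<le> \<mu> powr ?a * snr_cdf Q r E X \<mu> x"
      unfolding F by (intro mult_left_mono b) auto
    thus "c * x powr ?a * e \<mu> x \<le> \<mu> powr ?a * snr_cdf Q r E X \<mu> x"
      unfolding scale[OF that, symmetric] e_def by (simp only: mult.assoc)
  qed
  have "((\<lambda>\<mu>. \<mu> powr ?a * aber p q (snr_cdf Q r E X \<mu>)) \<longlongrightarrow>
      c * Gamma (p + ?a) / (2 * Gamma p * q powr ?a)) at_top"
  proof (rule aber_scaled_tendsto)
    \<comment> \<open>A distribution function is monotone, hence Borel measurable.\<close>
    show "snr_cdf Q r E X \<mu> \<in> borel_measurable borel" for \<mu>
    proof -
      have "prob_space (distr Q borel (snr r E \<mu> X))"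
        by (intro prob_space_distr) (auto simp: snr_def)
      then interpret D: prob_space "distr Q borel (snr r E \<mu> X)" .
      have "finite_borel_measure (distr Q borel (snr r E \<mu> X))"
        by unfold_locales auto
      thus ?thesis
        unfolding snr_cdf_def
        by (intro borel_measurable_mono monoI finite_borel_measure.cdf_nondecreasing)
    qed
    show "0 \<le> snr_cdf Q r E X \<mu> x" for \<mu> x
      by (simp add: snr_cdf_def cdf_def)
    show "((\<lambda>\<mu>. \<mu> powr ?a * snr_cdf Q r E X \<mu> x) \<longlongrightarrow> c * x powr ?a) at_top" if "x > 0" for x
    proof (rule tendsto_sandwich)
      have "((\<lambda>\<mu>. (x / \<mu>) powr (1 / real r)) \<longlongrightarrow> 0) at_top"
        using assms that by real_asymp
      hence "((\<lambda>\<mu>. c * x powr ?a * e \<mu> x) \<longlongrightarrow> c * x powr ?a * exp (- (E * 0) / k)) at_top"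
        unfolding e_def using \<open>k > 0\<close> by (intro tendsto_intros) auto
      thus "((\<lambda>\<mu>. c * x powr ?a * e \<mu> x) \<longlongrightarrow> c * x powr ?a) at_top" by simp
      show "\<forall>\<^sub>F \<mu> in at_top. \<mu> powr ?a * snr_cdf Q r E X \<mu> x \<le> c * x powr ?a"
           "\<forall>\<^sub>F \<mu> in at_top. c * x powr ?a * e \<mu> x \<le> \<mu> powr ?a * snr_cdf Q r E X \<mu> x"
        using eventually_gt_at_top[of 0] by (eventually_elim; use * that in blast)+
    qed auto
  qed (use assms * in auto)
  thus ?thesis by (simp add: c_def mult_ac)
qed

text \<open>The limit is the one obtained for the scaled error rate itself. Since t_{1,1} = 1, the
  summand h = 1 has order \<mu>^(-l/r). For r = 1 it is the whole sum, and the scaled expression is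
  constant for \<mu> > 0.\<close>

lemma aber_inf_scaled_tendsto:
  assumes "r \<in> {1, 2}" "l > 0" "k > 0" "E > 0" "p > 0" "q > 0"
  shows "((\<lambda>\<mu>. \<mu> powr (l / real r) * aber_inf r p q l (Lambda3 r E l k) (Lambda4 r E k) \<mu>) \<longlongrightarrow>
      (E / k) powr l * Gamma (p + l / real r) /
        (l * Gamma l * (2 * Gamma p) * q powr (l / real r))) at_top"
    (is "(?f \<longlongrightarrow> ?L) at_top")
proof -
  have G: "Gamma l > 0" "Gamma (l / 2) > 0" "Gamma p > 0"
    using assms by (auto intro: Gamma_real_pos)
  \<comment> \<open>For h = 1 the denominator is Gamma (1 + l/r); this recurrence turns it into the
    factor l of the limit.\<close>
  have plus1: "Gamma (1 + x) = x * Gamma x" if "x > 0" for x :: real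
    using that Gamma_plus1[of x] by (auto simp: add.commute nonpos_Ints_def)
  consider "r = 1" | "r = 2" using assms by auto
  thus ?thesis
  proof cases
    case 1
    have "\<forall>\<^sub>F \<mu> in at_top. ?f \<mu> = ?L"
      using eventually_gt_at_top[of 0]
    proof eventually_elim
      case (elim \<mu>)
      thus ?case
        using assms G plus1[of l]
        by (auto simp: 1 aber_inf_def t1_def t2_def Lambda3_def Lambda4_def numeral_2_eq_2
            prod.atLeast_Suc_atMost powr_mult powr_divide powr_minus field_simps)
    qed
    thus ?thesis by (rule tendsto_eventually)
  next
    case 2
    let ?L3 = "Lambda3 2 E l k" and ?L4 = "Lambda4 2 E k"
    \<comment> \<open>The coefficient of the summand h = 2, where t_{1,2} = 1/2. Only its
      independence of \<mu> matters.\<close>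
    define C where "C = ?L3 * q powr (- (1 / 2) - l / 2) / (2 * sqrt 2 * Gamma p * ?L4 powr - (1 / 2))
       * (Gamma (- (1 / 2)) * (Gamma (1 / 2 + (p + l / 2)) * Gamma (1 / 2 + l / 2))
           / Gamma (1 / 2 + (1 + l / 2)))"
    have sets: "{1..2} = {1, 2::nat}" "{Suc 0, 2} - {2} = {Suc 0}"
      by auto
    \<comment> \<open>The factor \<open>sqrt pi\<close> is Gamma (t_{1,1} - t_{1,2}) = Gamma
      (1/2).\<close>
    have split: "aber_inf 2 p q l ?L3 ?L4 \<mu> =
        ?L3 * (q * \<mu>) powr (- (l / 2)) / (2 * sqrt 2 * Gamma p)
          * (sqrt pi * (Gamma (p + l / 2) * Gamma (l / 2)) / Gamma (1 + l / 2))
        + C * \<mu> powr (- (1 / 2) - l / 2)" if "\<mu> > 0" for \<mu>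
    proof -
      have "?L4 > 0" using assms by (simp add: Lambda4_def)
      thus ?thesis
        using that assms unfolding aber_inf_def sets(1)
        by (simp add: sets(2) t1_def t2_def C_def Gamma_one_half_real powr_mult add_ac)
    qed
    \<comment> \<open>The factor sqrt (2 pi) in \<open>Lambda3\<close> cancels
      \<open>sqrt pi\<close> and combines its \<open>sqrt 2\<close> with \<open>sqrt r\<close> to 2.
      This 2 cancels against Gamma (l/2) / Gamma (1 + l/2) = 2/l.\<close>
    have main: "?L3 * (q * \<mu>) powr (- (l / 2)) / (2 * sqrt 2 * Gamma p)
          * (sqrt pi * (Gamma (p + l / 2) * Gamma (l / 2)) / Gamma (1 + l / 2))
        = ?L * \<mu> powr (- (l / 2))" if "\<mu> > 0" for \<mu>
    proof -
      have L3: "?L3 = (E / k) powr l / (Gamma l * (sqrt 2 * sqrt pi))"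
        using assms by (simp add: Lambda3_def powr_divide powr_half_sqrt real_sqrt_mult)
      have sqrt2: "sqrt 2 * (sqrt 2 * x) = 2 * x" for x
        by (simp flip: mult.assoc)
      have Gamma_half: "Gamma (1 + l / 2) = l / 2 * Gamma (l / 2)"
        using assms by (intro plus1) simp
      show ?thesis
        unfolding L3 Gamma_half 2 using that assms G
        by (simp add: G[THEN less_imp_neq, THEN not_sym] powr_mult powr_divide powr_minus
            divide_simps sqrt2 mult_ac)
    qed
    have "\<forall>\<^sub>F \<mu> in at_top. ?f \<mu> = ?L + C * \<mu> powr (- 1 / 2)"
      using eventually_gt_at_top[of 0]
    proof eventually_elim
      case (elim \<mu>)
      have "\<mu> powr (l / 2) * \<mu> powr (- (l / 2)) = 1"
           "\<mu> powr (l / 2) * \<mu> powr (- (1 / 2) - l / 2) = \<mu> powr (- 1 / 2)"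
        using elim by (simp_all flip: powr_add)
      thus ?case
        unfolding 2 of_nat_numeral split[OF elim] main[OF elim, unfolded 2 of_nat_numeral]
        by (simp add: distrib_left mult.left_commute)
    qed
    moreover have "((\<lambda>\<mu>. ?L + C * \<mu> powr (- 1 / 2)) \<longlongrightarrow> ?L) at_top"
      by real_asymp
    ultimately show ?thesis by (simp add: tendsto_cong)
  qed
qed

theorem mainTheorem4:
  fixes P :: "'a measure" and M :: "'a \<Rightarrow> real"
    and Q :: "'b measure" and Mbar :: "'b \<Rightarrow> real"
    and n r :: nat and p q E V l k :: real
  assumes "prob_space P"
    and "M \<in> borel_measurable P"
    and "AE \<omega> in P. M \<omega> > 0"
    and "integrable P M"
    and "integrable P (\<lambda>\<omega>. (M \<omega>)\<^sup>2)"
    and "E = prob_space.expectation P M" and "E > 0"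
    and "V = prob_space.variance P M" and "V > 0"
    and "n \<ge> 1"
    and "l = l_d n E V" and "k = k_d E V"
    and "prob_space Q"
    and "distributed Q lborel Mbar (\<lambda>y. ennreal (gamma_density l k y))"
    and "r \<in> {1, 2}" and "p > 0" and "q > 0"
  shows "((\<lambda>\<mu>. aber p q (snr_cdf Q r E Mbar \<mu>)
             / aber_inf r p q l (Lambda3 r E l k) (Lambda4 r E k) \<mu>) \<longlongrightarrow> 1) at_top"
proof -
  have "k > 0" "l > 0"
    using assms by (simp_all add: k_d_def l_d_def)
  let ?A = "\<lambda>\<mu>. aber p q (snr_cdf Q r E Mbar \<mu>)"
  let ?B = "aber_inf r p q l (Lambda3 r E l k) (Lambda4 r E k)"
  \<comment> \<open>The common limit of both scaled quantities. It is positive, so the limits may be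
    divided, and the scaling factors cancel in the quotient for \<mu> > 0.\<close>
  let ?L = "(E / k) powr l * Gamma (p + l / real r) /
        (l * Gamma l * (2 * Gamma p) * q powr (l / real r))"
  have "r > 0" using assms by auto
  have "Gamma l > 0" "Gamma p > 0" "Gamma (p + l / real r) > 0"
    using \<open>l > 0\<close> \<open>p > 0\<close> \<open>r > 0\<close> by (auto intro!: Gamma_real_pos add_pos_pos)
  hence "?L > 0"
    using \<open>l > 0\<close> \<open>k > 0\<close> \<open>E > 0\<close> \<open>q > 0\<close>
    by (intro divide_pos_pos mult_pos_pos) simp_all
  hence "?L \<noteq> 0" by linarith
  have "((\<lambda>\<mu>. (\<mu> powr (l / real r) * ?A \<mu>) / (\<mu> powr (l / real r) * ?B \<mu>)) \<longlongrightarrow> ?L / ?L) at_top"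
    using assms \<open>k > 0\<close> \<open>l > 0\<close> \<open>r > 0\<close> \<open>?L \<noteq> 0\<close>
    by (intro tendsto_divide aber_snr_scaled_tendsto aber_inf_scaled_tendsto) blast+
  moreover have "\<forall>\<^sub>F \<mu> in at_top.
      (\<mu> powr (l / real r) * ?A \<mu>) / (\<mu> powr (l / real r) * ?B \<mu>) = ?A \<mu> / ?B \<mu>"
    using eventually_gt_at_top[of 0] by eventually_elim simp
  ultimately show ?thesis
    using \<open>?L \<noteq> 0\<close> by (simp add: tendsto_cong)
qed

end
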